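(* Let $R$ be a hemiring and let $\delta$ be a non-constant fuzzy $h$-ideal of $R$. Then $\delta$ is prime in the second sense if and only if each proper level set $U(\delta;t)$ of $\delta$ (i.e. each $U(\delta;t)$, $t\in[0,1]$, with $\emptyset\neq U(\delta;t)\neq R$) is a prime $h$-ideal of $R$.
   Context: A hemiring is a set $R$ with operations $+$ and $\cdot$ such that $(R,+)$ is a commutative semigroup, $(R,\cdot)$ is a semigroup, multiplication distributes over addition on both sides, and there is $0\in R$ with $a+0=0+a=a$ and $a0=0a=0$ for all $a\in R$. An $h$-ideal of $R$ is a non-empty subset $I$ closed under addition, with $ra,ar\in I$ for all $a\in I$, $r\in R$, and such that $x+a+y=b+y$ with $a,b\in I$, $x,y\in R$ implies $x\in I$. An $h$-ideal $P$ is prime if $P\neq R$ and for any $h$-ideals $A,B$ of $R$, $AB\subseteq P$ implies $A\subseteq P$ or $B\subseteq P$ (here $AB$ is the set of finite sums of products $ab$, $a\in A$, $b\in B$). A fuzzy subset of $R$ is a map $\lambda:R\to[0,1]$; $\wedge$ denotes minimum. A fuzzy $h$-ideal of $R$ is a fuzzy subset $\lambda$ such that for all $a,b,x,y\in R$: $\lambda(a+b)\geq\lambda(a)\wedge\lambda(b)$; $\lambda(ab)\geq\lambda(a)$ and $\lambda(ab)\geq\lambda(b)$; and $x+a+y=b+y$ implies $\lambda(x)\geq\lambda(a)\wedge\lambda(b)$. The level sets are $U(\delta;t)=\{x\in R\mid\delta(x)\geq t\}$. A non-constant fuzzy $h$-ideal $\delta$ is prime in the second sense if for all $t\in[0,1]$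 and $a,b\in R$: if $\delta(axb)\geq t$ for every $x\in R$, then $\delta(a)\geq t$ or $\delta(b)\geq t$. *)

theory Defs
  imports Complex_Main
begin

text \<open>
  A hemiring is exactly an instance of the library class \<open>semiring_0\<close>: a commutative additive
  monoid (so the zero is additively neutral), an associative multiplication distributing over
  addition on both sides, and an absorbing zero. There is no unit, no commutativity of
  multiplication and no additive cancellation. The hemiring $R$ is the whole type \<open>'a\<close>.
\<close>

definition h_ideal :: "('a::semiring_0) set \<Rightarrow> bool" where
  "h_ideal I \<longleftrightarrow>
     I \<noteq> {} \<and>
     (\<forall>a\<in>I. \<forall>b\<in>I. a + b \<in> I) \<and>
     (\<forall>a\<in>I. \<forall>r. r * a \<in> I \<and> a * r \<in> I) \<and>
     (\<forall>a\<in>I. \<forall>b\<in>I. \<forall>x y. x + a + y = b + y \<longrightarrow> x \<in> I)"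

text \<open>The empty sum is allowed; for h-ideals this changes nothing, since they contain 0.\<close>

definition ideal_prod :: "('a::semiring_0) set \<Rightarrow> 'a set \<Rightarrow> 'a set" where
  "ideal_prod A B =
     {(\<Sum>i<n. f i * g i) | (n::nat) f g. (\<forall>i<n. f i \<in> A \<and> g i \<in> B)}"

definition prime_h_ideal :: "('a::semiring_0) set \<Rightarrow> bool" where
  "prime_h_ideal P \<longleftrightarrow>
     h_ideal P \<and> P \<noteq> UNIV \<and>
     (\<forall>A B. h_ideal A \<longrightarrow> h_ideal B \<longrightarrow> ideal_prod A B \<subseteq> P \<longrightarrow> A \<subseteq> P \<or> B \<subseteq> P)"

definition fuzzy_subset :: "('a \<Rightarrow> real) \<Rightarrow> bool" where
  "fuzzy_subset \<mu> \<longleftrightarrow> (\<forall>x. \<mu> x \<in> {0..1})"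

definition fuzzy_h_ideal :: "('a::semiring_0 \<Rightarrow> real) \<Rightarrow> bool" where
  "fuzzy_h_ideal \<mu> \<longleftrightarrow>
     fuzzy_subset \<mu> \<and>
     (\<forall>a b. \<mu> (a + b) \<ge> min (\<mu> a) (\<mu> b)) \<and>
     (\<forall>a b. \<mu> (a * b) \<ge> \<mu> a \<and> \<mu> (a * b) \<ge> \<mu> b) \<and>
     (\<forall>a b x y. x + a + y = b + y \<longrightarrow> \<mu> x \<ge> min (\<mu> a) (\<mu> b))"

definition level_set :: "('a \<Rightarrow> real) \<Rightarrow> real \<Rightarrow> 'a set" where
  "level_set \<delta> t = {x. \<delta> x \<ge> t}"

definition non_constant :: "('a \<Rightarrow> real) \<Rightarrow> bool" where
  "non_constant \<delta> \<longleftrightarrow> (\<exists>x y. \<delta> x \<noteq> \<delta> y)"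

definition prime_second_sense :: "('a::semiring_0 \<Rightarrow> real) \<Rightarrow> bool" where
  "prime_second_sense \<delta> \<longleftrightarrow>
     fuzzy_h_ideal \<delta> \<and> non_constant \<delta> \<and>
     (\<forall>t\<in>{0..1}. \<forall>a b. (\<forall>x. \<delta> (a * x * b) \<ge> t) \<longrightarrow> \<delta> a \<ge> t \<or> \<delta> b \<ge> t)"

end

theory Submission
  imports Defs
begin

text \<open>
  Level sets of a fuzzy h-ideal are h-ideals, so the claim reduces to the equivalence, for a proper
  h-ideal \<open>P\<close>, of ideal-wise primeness with the element-wise condition that \<open>a R b \<subseteq> P\<close>
  forces \<open>a \<in> P\<close> or \<open>b \<in> P\<close>. Only the passage to elements is delicate, as there is no unit and
  generated h-ideals are awkward. Instead, residuals are used: \<open>B = {v. a R v \<subseteq> P}\<close> and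
  \<open>C = {u. u B \<subseteq> P}\<close> are h-ideals with \<open>C B \<subseteq> P\<close>, \<open>b \<in> B\<close> and \<open>a R \<subseteq> C\<close>. Hence \<open>b \<in> P\<close> or
  \<open>a R \<subseteq> P\<close>, and in the latter case \<open>D = {u. u R \<subseteq> P}\<close> contains \<open>a\<close> and satisfies \<open>D R \<subseteq> P\<close>,
  so \<open>a \<in> P\<close>.
\<close>

lemma h_idealI:
  assumes "I \<noteq> {}"
    and "\<And>a b. a \<in> I \<Longrightarrow> b \<in> I \<Longrightarrow> a + b \<in> I"
    and "\<And>a r. a \<in> I \<Longrightarrow> r * a \<in> I"
    and "\<And>a r. a \<in> I \<Longrightarrow> a * r \<in> I"
    and "\<And>a b x y. a \<in> I \<Longrightarrow> b \<in> I \<Longrightarrow> x + a + y = b + y \<Longrightarrow> x \<in> I"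
  shows "h_ideal I"
  using assms unfolding h_ideal_def by blast

lemma
  assumes "h_ideal I"
  shows h_ideal_nonempty: "I \<noteq> {}"
    and h_ideal_add: "a \<in> I \<Longrightarrow> b \<in> I \<Longrightarrow> a + b \<in> I"
    and h_ideal_mult_left: "a \<in> I \<Longrightarrow> r * a \<in> I"
    and h_ideal_mult_right: "a \<in> I \<Longrightarrow> a * r \<in> I"
    and h_ideal_closed: "a \<in> I \<Longrightarrow> b \<in> I \<Longrightarrow> x + a + y = b + y \<Longrightarrow> x \<in> I"
  using assms unfolding h_ideal_def by blast+

lemma h_ideal_zero: "h_ideal I \<Longrightarrow> 0 \<in> I"
  by (metis equals0I h_ideal_mult_left h_ideal_nonempty mult_zero_left)

lemma h_ideal_UNIV: "h_ideal UNIV"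
  by (simp add: h_ideal_def)

text \<open>Right multiplication by \<open>v\<close> is additive, so it carries the relation
  \<open>x + a + y = b + y\<close> to one between products, where closure of \<open>P\<close>
  applies. Stability of \<open>T\<close> gives closure under right multiples:
  \<open>(u * r) * v = u * (r * v)\<close> with \<open>r * v\<close> again in
  \<open>T\<close>.\<close>

lemma h_ideal_left_residual:
  assumes P: "h_ideal P" and T: "\<And>v r. v \<in> T \<Longrightarrow> r * v \<in> T"
  shows "h_ideal {u. \<forall>v\<in>T. u * v \<in> P}"
proof (rule h_idealI; (clarsimp simp: mult.assoc distrib_right)?)
  show "\<exists>u. \<forall>v\<in>T. u * v \<in> P"
    using h_ideal_zero[OF P] by (intro exI[of _ 0]) simp
next
  fix a b x y v
  assume "\<forall>v\<in>T. a * v \<in> P" "\<forall>v\<in>T. b * v \<in> P" "x + a + y = b + y" "v \<in> T"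
  then show "x * v \<in> P"
    using h_ideal_closed[OF P, of "a * v" "b * v" "x * v" "y * v"] by (metis distrib_right)
qed (use T in \<open>auto intro: h_ideal_add[OF P] h_ideal_mult_left[OF P]\<close>)

text \<open>Mirror image of \<open>h_ideal_left_residual\<close>, with
  \<open>u * (r * v) = (u * r) * v\<close>.\<close>

lemma h_ideal_right_residual:
  assumes P: "h_ideal P" and T: "\<And>u r. u \<in> T \<Longrightarrow> u * r \<in> T"
  shows "h_ideal {v. \<forall>u\<in>T. u * v \<in> P}"
proof (rule h_idealI; (clarsimp simp: mult.assoc[symmetric] distrib_left)?)
  show "\<exists>v. \<forall>u\<in>T. u * v \<in> P"
    using h_ideal_zero[OF P] by (intro exI[of _ 0]) simp
next
  fix a b x y u
  assume "\<forall>u\<in>T. u * a \<in> P" "\<forall>u\<in>T. u * b \<in> P" "x + a + y = b + y" "u \<in> T"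
  then show "u * x \<in> P"
    using h_ideal_closed[OF P, of "u * a" "u * b" "u * x" "u * y"] by (metis distrib_left)
qed (use T in \<open>auto intro: h_ideal_add[OF P] h_ideal_mult_right[OF P]\<close>)

text \<open>A single product is a sum of length 1; conversely, \<open>P\<close> contains the empty
  sum 0 and is closed under addition.\<close>

lemma ideal_prod_subset_iff:
  assumes P: "h_ideal P"
  shows "ideal_prod A B \<subseteq> P \<longleftrightarrow> (\<forall>a\<in>A. \<forall>b\<in>B. a * b \<in> P)"
proof
  assume sub: "ideal_prod A B \<subseteq> P"
  show "\<forall>a\<in>A. \<forall>b\<in>B. a * b \<in> P"
  proof (intro ballI)
    fix a b assume "a \<in> A" "b \<in> B"
    then have "a * b \<in> ideal_prod A B"
      unfolding ideal_prod_def
      by (intro CollectI exI[of _ "1::nat"] exI[of _ "\<lambda>_. a"] exI[of _ "\<lambda>_. b"]) simp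
    with sub show "a * b \<in> P" by blast
  qed
next
  assume prods: "\<forall>a\<in>A. \<forall>b\<in>B. a * b \<in> P"
  have "(\<Sum>i<n. f i * g i) \<in> P" if "\<forall>i<n. f i \<in> A \<and> g i \<in> B" for n :: nat and f g
    using that prods by (induction n) (auto intro: h_ideal_zero[OF P] h_ideal_add[OF P])
  then show "ideal_prod A B \<subseteq> P"
    unfolding ideal_prod_def by blast
qed

lemma prime_h_ideal_iff_elementwise:
  assumes P: "h_ideal P"
  shows "prime_h_ideal P \<longleftrightarrow>
    P \<noteq> UNIV \<and> (\<forall>a b. (\<forall>x. a * x * b \<in> P) \<longrightarrow> a \<in> P \<or> b \<in> P)"
proof (intro iffI conjI allI impI)
  fix a b
  assume prime: "prime_h_ideal P" and aRb: "\<forall>x. a * x * b \<in> P"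
  have primeD: "A \<subseteq> P \<or> B \<subseteq> P"
    if "h_ideal A" "h_ideal B" "\<And>u v. u \<in> A \<Longrightarrow> v \<in> B \<Longrightarrow> u * v \<in> P" for A B
    using prime that ideal_prod_subset_iff[OF P] unfolding prime_h_ideal_def by blast
  define B where "B = {v. \<forall>u\<in>range ((*) a). u * v \<in> P}"
  define C where "C = {u. \<forall>v\<in>B. u * v \<in> P}"
  define D where "D = {u. \<forall>r\<in>UNIV. u * r \<in> P}"
  have B: "h_ideal B"
    unfolding B_def by (rule h_ideal_right_residual[OF P]) (auto simp: mult.assoc)
  have C: "h_ideal C"
    unfolding C_def by (rule h_ideal_left_residual[OF P]) (rule h_ideal_mult_left[OF B])
  have D: "h_ideal D"
    unfolding D_def by (rule h_ideal_left_residual[OF P]) simp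
  have "C \<subseteq> P \<or> B \<subseteq> P"
    using primeD[OF C B] by (simp add: C_def)
  then show "a \<in> P \<or> b \<in> P"
  proof
    assume "B \<subseteq> P"
    moreover have "b \<in> B" using aRb by (simp add: B_def)
    ultimately show ?thesis by blast
  next
    assume "C \<subseteq> P"
    \<comment> \<open>For \<open>v\<close> in \<open>B\<close>, the product
      \<open>(a * r) * v\<close> lies in \<open>P\<close> by the choice of \<open>B\<close>.\<close>
    moreover have "a * r \<in> C" for r by (simp add: B_def C_def)
    ultimately have "a \<in> D" by (auto simp: D_def)
    \<comment> \<open>Primeness is applied to \<open>D\<close> and the whole hemiring; the
      alternative \<open>UNIV \<subseteq> P\<close> is excluded because \<open>P\<close> is
      proper.\<close>
    moreover have "D \<subseteq> P"
      using primeD[OF D h_ideal_UNIV] prime by (auto simp: D_def prime_h_ideal_def)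
    ultimately show ?thesis by blast
  qed
next
  assume elementwise: "P \<noteq> UNIV \<and> (\<forall>a b. (\<forall>x. a * x * b \<in> P) \<longrightarrow> a \<in> P \<or> b \<in> P)"
  \<comment> \<open>If \<open>a\<close> in \<open>A\<close> lies outside \<open>P\<close>, then for
    every \<open>b\<close> in \<open>B\<close> all \<open>(a * x) * b\<close> lie in
    \<open>P\<close>, since \<open>a * x\<close> is in \<open>A\<close>; hence \<open>b\<close> is
    in \<open>P\<close>.\<close>
  have "A \<subseteq> P \<or> B \<subseteq> P" if A: "h_ideal A" and AB: "\<forall>a\<in>A. \<forall>b\<in>B. a * b \<in> P" for A B
    using elementwise AB h_ideal_mult_right[OF A] by (meson subsetI)
  with P elementwise show "prime_h_ideal P"
    unfolding prime_h_ideal_def by (simp add: ideal_prod_subset_iff)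
qed (auto simp: prime_h_ideal_def)

lemma h_ideal_level_set:
  assumes "fuzzy_h_ideal \<delta>" and "level_set \<delta> t \<noteq> {}"
  shows "h_ideal (level_set \<delta> t)"
proof (rule h_idealI)
  fix a b x y
  assume "a \<in> level_set \<delta> t" "b \<in> level_set \<delta> t" "x + a + y = b + y"
  moreover from this have "\<delta> x \<ge> min (\<delta> a) (\<delta> b)"
    using assms(1) unfolding fuzzy_h_ideal_def by blast
  ultimately show "x \<in> level_set \<delta> t" by (simp add: level_set_def)
next
  fix a b
  assume "a \<in> level_set \<delta> t" "b \<in> level_set \<delta> t"
  moreover have "\<delta> (a + b) \<ge> min (\<delta> a) (\<delta> b)"
    using assms(1) unfolding fuzzy_h_ideal_def by blast
  ultimately show "a + b \<in> level_set \<delta> t" by (simp add: level_set_def)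
qed (use assms in \<open>auto simp: level_set_def fuzzy_h_ideal_def intro: order_trans\<close>)

theorem theorem5p6:
  fixes \<delta> :: "'a::semiring_0 \<Rightarrow> real"
  assumes "fuzzy_h_ideal \<delta>" and "non_constant \<delta>"
  shows "prime_second_sense \<delta> \<longleftrightarrow>
    (\<forall>t\<in>{0..1}. level_set \<delta> t \<noteq> {} \<longrightarrow> level_set \<delta> t \<noteq> UNIV \<longrightarrow> prime_h_ideal (level_set \<delta> t))"
proof -
  \<comment> \<open>The equivalence holds for each \<open>t\<close> separately. For an empty level
    set the premise on the right fails, and for a full one its conclusion is automatic.\<close>
  have "(level_set \<delta> t \<noteq> {} \<longrightarrow> level_set \<delta> t \<noteq> UNIV \<longrightarrow> prime_h_ideal (level_set \<delta> t)) \<longleftrightarrow>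
      (\<forall>a b. (\<forall>x. \<delta> (a * x * b) \<ge> t) \<longrightarrow> \<delta> a \<ge> t \<or> \<delta> b \<ge> t)" for t
  proof -
    have level: "\<delta> x \<ge> t \<longleftrightarrow> x \<in> level_set \<delta> t" for x
      by (simp add: level_set_def)
    show ?thesis
      unfolding level
      using prime_h_ideal_iff_elementwise[OF h_ideal_level_set[OF assms(1)], of t] by blast
  qed
  with assms show ?thesis
    unfolding prime_second_sense_def by simp
qed

end
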